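(* Every closed injective system $\{X_i,Y_i,f_i\}$ has a fundamental limit space.
   Context: $\mathbb{N}=\{0,1,2,\dots\}$. A closed injective system (CIS) $\{X_i,Y_i,f_i\}$ consists, for each $i\in\mathbb{N}$, of a nonempty topological space $X_i$, a closed subspace $Y_i\subset X_i$ and a closed injective continuous map $f_i:Y_i\to X_{i+1}$. Semicomponibility. Each $f_i$ is semicomponible with itself; put $Y_{i,i}=Y_i$, $f_{i,i}=f_i$. For $j>i$, inductively, $f_i$ and $f_j$ are semicomponible if $f_i$ and $f_{j-1}$ are semicomponible and $f_{i,j-1}(Y_{i,j-1})\cap Y_j\neq\emptyset$; in that case $Y_{i,j}=f_{i,j-1}^{-1}(Y_j)$ and $f_{i,j}:Y_{i,j}\to X_{j+1}$ is $f_{i,j}(y)=f_j(f_{i,j-1}(y))$. A limit space for the CIS is a topological space $X$ with continuous maps $\phi_i:X_i\to X$ ($i\in\mathbb{N}$) such that: (1) $X=\bigcup_{i}\phi_i(X_i)$; (2) each $\phi_i$ is an embedding (a homeomorphism onto its image); (3) if $i<j$ and $f_i$, $f_{j-1}$ are semicomponible, then $\phi_i(X_i)\cap\phi_j(X_j)=\phi_j(f_{i,j-1}(Y_{i,j-1}))$, and whenever $\phi_i(x_i)=\phi_j(x_j)$ with $x_i\in X_i$, $x_j\in X_j$, one has $x_i\in Y_{i,j-1}$ and $x_j=f_{i,j-1}(x_i)$; (4) if $i<j$ and $f_i$, $f_{j-1}$ are not semicomponible, then $\phi_i(X_i)\cap\phi_j(X_j)=\emptyset$. A fundamental limit space is a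 limit space $\{X,\phi_i\}$ such that $X$ has the weak topology: a subset $A\subset X$ is closed in $X$ if and only if $\phi_i^{-1}(A)$ is closed in $X_i$ for all $i\in\mathbb{N}$. *)

theory Defs
  imports "HOL-Analysis.Analysis"
begin

text \<open>
  All spaces of a system are carried by subsets of one type \<open>'a\<close>; the topologies \<open>X i\<close> and
  their underlying sets \<open>topspace (X i)\<close> are otherwise unrelated, and \<open>f i\<close> matters only on \<open>Y i\<close>.
\<close>

definition closed_injective_system ::
  "(nat \<Rightarrow> 'a topology) \<Rightarrow> (nat \<Rightarrow> 'a set) \<Rightarrow> (nat \<Rightarrow> 'a \<Rightarrow> 'a) \<Rightarrow> bool" where
  "closed_injective_system X Y f \<longleftrightarrow>
    (\<forall>i. topspace (X i) \<noteq> {} \<and>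
         closedin (X i) (Y i) \<and>
         continuous_map (subtopology (X i) (Y i)) (X (Suc i)) (f i) \<and>
         closed_map (subtopology (X i) (Y i)) (X (Suc i)) (f i) \<and>
         inj_on (f i) (Y i))"

text \<open>
  The map \<open>f_{i,j}\<close> and its domain \<open>Y_{i,j}\<close>. They are meaningful only if \<open>i \<le> j\<close> and
  \<open>f i\<close>, \<open>f j\<close> are semicomponible; for \<open>j < i\<close> they take the irrelevant values \<open>f i\<close> and \<open>Y i\<close>.
\<close>

primrec comp_map :: "(nat \<Rightarrow> 'a \<Rightarrow> 'a) \<Rightarrow> nat \<Rightarrow> nat \<Rightarrow> 'a \<Rightarrow> 'a" where
  "comp_map f i 0 = f i"
| "comp_map f i (Suc j) =
    (if Suc j \<le> i then f i else (\<lambda>y. f (Suc j) (comp_map f i j y)))"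

primrec comp_dom :: "(nat \<Rightarrow> 'a set) \<Rightarrow> (nat \<Rightarrow> 'a \<Rightarrow> 'a) \<Rightarrow> nat \<Rightarrow> nat \<Rightarrow> 'a set" where
  "comp_dom Y f i 0 = Y i"
| "comp_dom Y f i (Suc j) =
    (if Suc j \<le> i then Y i else {y \<in> comp_dom Y f i j. comp_map f i j y \<in> Y (Suc j)})"

inductive semicomponible ::
  "(nat \<Rightarrow> 'a set) \<Rightarrow> (nat \<Rightarrow> 'a \<Rightarrow> 'a) \<Rightarrow> nat \<Rightarrow> nat \<Rightarrow> bool"
  for Y :: "nat \<Rightarrow> 'a set" and f :: "nat \<Rightarrow> 'a \<Rightarrow> 'a" where
  self: "semicomponible Y f i i"
| step: "semicomponible Y f i j \<Longrightarrow> comp_map f i j ` comp_dom Y f i j \<inter> Y (Suc j) \<noteq> {}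
    \<Longrightarrow> semicomponible Y f i (Suc j)"

definition limit_space ::
  "(nat \<Rightarrow> 'a topology) \<Rightarrow> (nat \<Rightarrow> 'a set) \<Rightarrow> (nat \<Rightarrow> 'a \<Rightarrow> 'a) \<Rightarrow>
   'b topology \<Rightarrow> (nat \<Rightarrow> 'a \<Rightarrow> 'b) \<Rightarrow> bool" where
  "limit_space X Y f L \<phi> \<longleftrightarrow>
    (\<forall>i. continuous_map (X i) L (\<phi> i)) \<and>
    topspace L = (\<Union>i. \<phi> i ` topspace (X i)) \<and>
    (\<forall>i. embedding_map (X i) L (\<phi> i)) \<and>
    (\<forall>i j. i < j \<and> semicomponible Y f i (j - 1) \<longrightarrow>
       \<phi> i ` topspace (X i) \<inter> \<phi> j ` topspace (X j) =
         \<phi> j ` (comp_map f i (j - 1) ` comp_dom Y f i (j - 1)) \<and>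
       (\<forall>x \<in> topspace (X i). \<forall>y \<in> topspace (X j). \<phi> i x = \<phi> j y \<longrightarrow>
          x \<in> comp_dom Y f i (j - 1) \<and> y = comp_map f i (j - 1) x)) \<and>
    (\<forall>i j. i < j \<and> \<not> semicomponible Y f i (j - 1) \<longrightarrow>
       \<phi> i ` topspace (X i) \<inter> \<phi> j ` topspace (X j) = {})"

definition fundamental_limit_space ::
  "(nat \<Rightarrow> 'a topology) \<Rightarrow> (nat \<Rightarrow> 'a set) \<Rightarrow> (nat \<Rightarrow> 'a \<Rightarrow> 'a) \<Rightarrow>
   'b topology \<Rightarrow> (nat \<Rightarrow> 'a \<Rightarrow> 'b) \<Rightarrow> bool" where
  "fundamental_limit_space X Y f L \<phi> \<longleftrightarrow>
    limit_space X Y f L \<phi> \<and>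
    (\<forall>A \<subseteq> topspace L. closedin L A \<longleftrightarrow>
       (\<forall>i. closedin (X i) {x \<in> topspace (X i). \<phi> i x \<in> A}))"

end

theory Submission
  imports Defs
begin

text \<open>
  Glue the disjoint union of the \<open>X i\<close> along the steps \<open>(i, x) \<mapsto> (i + 1, f i x)\<close>, \<open>x \<in> Y i\<close>.
  The step relation and its converse are single-valued, so two points are identified iff one is
  reached from the other by steps. The quotient carries the final topology. The trace on \<open>X j\<close> of
  the image of a closed set \<open>C \<subseteq> X i\<close> is an iterated image or preimage of \<open>C\<close> under the closed
  continuous maps \<open>f k\<close>, so the canonical maps are closed, injective and continuous.
\<close>

section \<open>Steps between the spaces and the gluing relation\<close>

definition step_rel :: "(nat \<Rightarrow> 'a set) \<Rightarrow> (nat \<Rightarrow> 'a \<Rightarrow> 'a) \<Rightarrow> (nat \<times> 'a) rel" where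
  "step_rel Y f = {((i, x), (Suc i, f i x)) | i x. x \<in> Y i}"

definition glue_rel :: "(nat \<Rightarrow> 'a set) \<Rightarrow> (nat \<Rightarrow> 'a \<Rightarrow> 'a) \<Rightarrow> (nat \<times> 'a) rel" where
  "glue_rel Y f = (step_rel Y f)\<^sup>* \<union> ((step_rel Y f)\<^sup>*)\<inverse>"

text \<open>Classes are taken in all of \<open>nat \<times> 'a\<close>, so that
  \<open>glue_rel\<close> can be an equivalence on \<open>UNIV\<close>. In a closed injective system
  a pair (i, x) with x outside \<open>X i\<close> meets no step and forms a class of its
  own.\<close>

definition glue_map :: "(nat \<Rightarrow> 'a set) \<Rightarrow> (nat \<Rightarrow> 'a \<Rightarrow> 'a) \<Rightarrow> nat \<Rightarrow> 'a \<Rightarrow> (nat \<times> 'a) set" where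
  "glue_map Y f i x = glue_rel Y f `` {(i, x)}"

lemma step_rtrancl_le:
  assumes "((i, x), (j, y)) \<in> (step_rel Y f)\<^sup>*"
  shows "i \<le> j"
  using assms by (induction "(i, x)" "(j, y)" arbitrary: j y rule: rtrancl.induct)
    (auto simp: step_rel_def le_Suc_eq)

text \<open>The bound on i excludes the empty path, so there is a last step, and it starts at index
  k.\<close>

lemma step_rtrancl_Suc:
  assumes "i \<le> k"
  shows "((i, x), (Suc k, y)) \<in> (step_rel Y f)\<^sup>* \<longleftrightarrow>
    (\<exists>z\<in>Y k. ((i, x), (k, z)) \<in> (step_rel Y f)\<^sup>* \<and> y = f k z)"
proof
  assume "((i, x), (Suc k, y)) \<in> (step_rel Y f)\<^sup>*"
  then show "\<exists>z\<in>Y k. ((i, x), (k, z)) \<in> (step_rel Y f)\<^sup>* \<and> y = f k z"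
    using assms by (cases rule: rtranclE) (auto simp: step_rel_def)
next
  assume "\<exists>z\<in>Y k. ((i, x), (k, z)) \<in> (step_rel Y f)\<^sup>* \<and> y = f k z"
  then obtain z where "z \<in> Y k" "((i, x), (k, z)) \<in> (step_rel Y f)\<^sup>*" "y = f k z"
    by blast
  moreover from this have "((k, z), (Suc k, y)) \<in> step_rel Y f"
    by (auto simp: step_rel_def)
  ultimately show "((i, x), (Suc k, y)) \<in> (step_rel Y f)\<^sup>*"
    by (meson rtrancl.rtrancl_into_rtrancl)
qed

lemma step_rtrancl_same [simp]:
  "((i, x), (i, y)) \<in> (step_rel Y f)\<^sup>* \<longleftrightarrow> x = y"
proof
  assume "((i, x), (i, y)) \<in> (step_rel Y f)\<^sup>*"
  then show "x = y"
  proof (cases rule: rtranclE)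
    case (step p)
    then show ?thesis using step_rtrancl_le[of i x "fst p" "snd p" Y f] by (auto simp: step_rel_def)
  qed simp
qed auto

text \<open>Splitting off the last step reproduces the recursion of \<open>comp_map\<close> and
  \<open>comp_dom\<close>. The index shift arises because f_{i,k} takes values in the space with
  index k + 1.\<close>

lemma step_rtrancl_iff_comp:
  assumes "i \<le> k"
  shows "((i, x), (Suc k, y)) \<in> (step_rel Y f)\<^sup>* \<longleftrightarrow>
    x \<in> comp_dom Y f i k \<and> y = comp_map f i k x"
  using assms
proof (induction k arbitrary: y rule: dec_induct)
  case base
  \<comment> \<open>The diagonal value comes from the equation at 0 if i = 0, and from the branch
    \<open>Suc j \<le> i\<close> otherwise.\<close>
  have "comp_dom Y f i i = Y i" "comp_map f i i = f i"
    by (cases i; simp)+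
  then show ?case by (auto simp: step_rtrancl_Suc)
next
  case (step k)
  then have "i \<le> Suc k" by simp
  show ?case
    unfolding step_rtrancl_Suc[OF \<open>i \<le> Suc k\<close>] step.IH using step.hyps by auto
qed

text \<open>A point of the domain at \<open>Suc k\<close> is also in the domain at k, and its image
  witnesses the nonempty intersection required by \<open>semicomponible.step\<close>. The
  contrapositive serves condition (4) of a limit space.\<close>

lemma comp_dom_nonempty_imp_semicomponible:
  assumes "i \<le> k" "comp_dom Y f i k \<noteq> {}"
  shows "semicomponible Y f i k"
  using assms
proof (induction k rule: dec_induct)
  case base
  show ?case by (rule semicomponible.self)
next
  case (step k)
  then have "comp_map f i k ` comp_dom Y f i k \<inter> Y (Suc k) \<noteq> {}" by auto
  then show ?case using step.IH by (intro semicomponible.step) auto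
qed

text \<open>Only transitivity needs an argument: two paths out of q are comparable because steps are
  single-valued, and two paths into q because injectivity makes the converse single-valued.\<close>

lemma equiv_glue_rel:
  assumes "\<And>i. inj_on (f i) (Y i)"
  shows "equiv UNIV (glue_rel Y f)"
proof (rule equivI)
  have sv: "single_valued (step_rel Y f)" "single_valued ((step_rel Y f)\<inverse>)"
    using assms by (auto simp: step_rel_def single_valued_def dest: inj_onD)
  show "trans (glue_rel Y f)"
  proof (rule transI)
    fix p q r
    assume "(p, q) \<in> glue_rel Y f" "(q, r) \<in> glue_rel Y f"
    then show "(p, r) \<in> glue_rel Y f"
      using single_valued_confluent[OF sv(1), of q p r]
        single_valued_confluent[OF sv(2), of q p r]
      unfolding glue_rel_def rtrancl_converse Un_iff converse_iff by (meson rtrancl_trans)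
  qed
qed (auto simp: glue_rel_def refl_on_def intro: symI)

lemma glue_map_eq_iff:
  assumes "\<And>i. inj_on (f i) (Y i)" "i \<le> j"
  shows "glue_map Y f i x = glue_map Y f j y \<longleftrightarrow> ((i, x), (j, y)) \<in> (step_rel Y f)\<^sup>*"
proof -
  have "glue_map Y f i x = glue_map Y f j y \<longleftrightarrow> ((i, x), (j, y)) \<in> glue_rel Y f"
    using eq_equiv_class_iff[OF equiv_glue_rel[OF assms(1)]] by (simp add: glue_map_def)
  \<comment> \<open>A path from (j, y) back to (i, x) forces i = j and then x = y, so it is also a
    path forward.\<close>
  also have "\<dots> \<longleftrightarrow> ((i, x), (j, y)) \<in> (step_rel Y f)\<^sup>*"
    using assms(2) step_rtrancl_le[of j y i x] step_rtrancl_same[of i]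
    unfolding glue_rel_def by (metis Un_iff converse_iff le_antisym)
  finally show ?thesis .
qed

section \<open>The final topology on the union of the images\<close>

definition final_topology ::
  "(nat \<Rightarrow> 'a topology) \<Rightarrow> (nat \<Rightarrow> 'a \<Rightarrow> 'b) \<Rightarrow> 'b topology" where
  "final_topology X \<phi> = topology (\<lambda>U. U \<subseteq> (\<Union>i. \<phi> i ` topspace (X i)) \<and>
     (\<forall>i. openin (X i) {x \<in> topspace (X i). \<phi> i x \<in> U}))"

text \<open>Preimages commute with intersections and unions, so the defining predicate satisfies
  \<open>istopology\<close>.\<close>

lemma openin_final_topology:
  "openin (final_topology X \<phi>) U \<longleftrightarrow> U \<subseteq> (\<Union>i. \<phi> i ` topspace (X i)) \<and>
     (\<forall>i. openin (X i) {x \<in> topspace (X i). \<phi> i x \<in> U})"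
proof -
  have "istopology (\<lambda>U. U \<subseteq> (\<Union>i. \<phi> i ` topspace (X i)) \<and>
     (\<forall>i. openin (X i) {x \<in> topspace (X i). \<phi> i x \<in> U}))" (is "istopology ?P")
    unfolding istopology_def
  proof (intro conjI allI impI)
    fix S T i assume "?P S" "?P T"
    then have "openin (X i) ({x \<in> topspace (X i). \<phi> i x \<in> S} \<inter> {x \<in> topspace (X i). \<phi> i x \<in> T})"
      by blast
    also have "{x \<in> topspace (X i). \<phi> i x \<in> S} \<inter> {x \<in> topspace (X i). \<phi> i x \<in> T}
        = {x \<in> topspace (X i). \<phi> i x \<in> S \<inter> T}"
      by blast
    finally show "openin (X i) {x \<in> topspace (X i). \<phi> i x \<in> S \<inter> T}" .
  next
    fix \<K> i assume "\<forall>K\<in>\<K>. ?P K"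
    then have "openin (X i) (\<Union>K\<in>\<K>. {x \<in> topspace (X i). \<phi> i x \<in> K})"
      by blast
    also have "(\<Union>K\<in>\<K>. {x \<in> topspace (X i). \<phi> i x \<in> K}) = {x \<in> topspace (X i). \<phi> i x \<in> \<Union>\<K>}"
      by blast
    finally show "openin (X i) {x \<in> topspace (X i). \<phi> i x \<in> \<Union>\<K>}" .
  qed blast+
  then show ?thesis by (simp add: final_topology_def)
qed

lemma topspace_final_topology:
  "topspace (final_topology X \<phi>) = (\<Union>i. \<phi> i ` topspace (X i))"
proof
  have "openin (final_topology X \<phi>) (\<Union>i. \<phi> i ` topspace (X i))"
    unfolding openin_final_topology
  proof (intro conjI allI)
    fix i
    have "{x \<in> topspace (X i). \<phi> i x \<in> (\<Union>i. \<phi> i ` topspace (X i))} = topspace (X i)"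
      by blast
    then show "openin (X i) {x \<in> topspace (X i). \<phi> i x \<in> (\<Union>i. \<phi> i ` topspace (X i))}"
      by simp
  qed simp
  then show "(\<Union>i. \<phi> i ` topspace (X i)) \<subseteq> topspace (final_topology X \<phi>)"
    by (rule openin_subset)
  show "topspace (final_topology X \<phi>) \<subseteq> (\<Union>i. \<phi> i ` topspace (X i))"
    using openin_final_topology[of X \<phi> "topspace (final_topology X \<phi>)"] by simp
qed

text \<open>Passing to complements, which preimages respect, turns the definition by open sets into
  the weak topology condition.\<close>

lemma closedin_final_topology:
  assumes "A \<subseteq> topspace (final_topology X \<phi>)"
  shows "closedin (final_topology X \<phi>) A \<longleftrightarrow>
    (\<forall>i. closedin (X i) {x \<in> topspace (X i). \<phi> i x \<in> A})"
proof -
  have "topspace (X i) - {x \<in> topspace (X i). \<phi> i x \<in> A}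
      = {x \<in> topspace (X i). \<phi> i x \<in> topspace (final_topology X \<phi>) - A}" for i
    by (auto simp: topspace_final_topology)
  moreover have "topspace (final_topology X \<phi>) - A \<subseteq> (\<Union>i. \<phi> i ` topspace (X i))"
    by (auto simp: topspace_final_topology)
  ultimately show ?thesis
    using assms by (auto simp: closedin_def openin_final_topology)
qed

lemma continuous_map_final_topology:
  "continuous_map (X i) (final_topology X \<phi>) (\<phi> i)"
  by (auto simp: continuous_map topspace_final_topology openin_final_topology)

section \<open>The canonical maps of a closed injective system\<close>

context
  fixes X :: "nat \<Rightarrow> 'a topology" and Y :: "nat \<Rightarrow> 'a set" and f :: "nat \<Rightarrow> 'a \<Rightarrow> 'a"
  assumes cis: "closed_injective_system X Y f"
begin

lemma cis_closedin: "closedin (X i) (Y i)"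
  and cis_continuous: "continuous_map (subtopology (X i) (Y i)) (X (Suc i)) (f i)"
  and cis_closed_map: "closed_map (subtopology (X i) (Y i)) (X (Suc i)) (f i)"
  and cis_inj: "inj_on (f i) (Y i)"
  using cis by (auto simp: closed_injective_system_def)

lemma cis_subset: "Y i \<subseteq> topspace (X i)"
  by (rule closedin_subset[OF cis_closedin])

lemma cis_maps_to: "x \<in> Y i \<Longrightarrow> f i x \<in> topspace (X (Suc i))"
  using continuous_map_funspace[OF cis_continuous, of i] cis_subset by auto

lemma step_rtrancl_topspace:
  assumes "i \<le> k" "((i, x), (Suc k, y)) \<in> (step_rel Y f)\<^sup>*"
  shows "x \<in> topspace (X i)" "y \<in> topspace (X (Suc k))"
proof -
  show "y \<in> topspace (X (Suc k))"
    using assms cis_maps_to by (auto simp: step_rtrancl_Suc)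
  show "x \<in> topspace (X i)"
    using assms(2)
  proof (cases rule: converse_rtranclE)
    \<comment> \<open>The empty path would give i = \<open>Suc k\<close>, against
      \<open>i \<le> k\<close>.\<close>
    case base
    then show ?thesis using assms(1) by simp
  next
    case (step p)
    then show ?thesis using cis_subset by (auto simp: step_rel_def)
  qed
qed

text \<open>Each further step cuts the set down to \<open>Y k\<close> and applies the closed map
  \<open>f k\<close>.\<close>

lemma closedin_step_image:
  assumes "i \<le> k" "closedin (X i) C"
  shows "closedin (X k) {y. \<exists>x\<in>C. ((i, x), (k, y)) \<in> (step_rel Y f)\<^sup>*}"
  using assms(1)
proof (induction k rule: dec_induct)
  case base
  show ?case using assms(2) by simp
next
  case (step k)
  let ?C = "{y. \<exists>x\<in>C. ((i, x), (k, y)) \<in> (step_rel Y f)\<^sup>*}"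
  have "closedin (subtopology (X k) (Y k)) (?C \<inter> Y k)"
    using step.IH closedin_subtopology by blast
  then have "closedin (X (Suc k)) (f k ` (?C \<inter> Y k))"
    using cis_closed_map by (auto simp: closed_map_def)
  also have "f k ` (?C \<inter> Y k) = {y. \<exists>x\<in>C. ((i, x), (Suc k, y)) \<in> (step_rel Y f)\<^sup>*}"
    using step.hyps by (auto simp: step_rtrancl_Suc)
  finally show ?case .
qed

text \<open>The last map is pulled back first, hence the induction over arbitrary C. Continuity
  gives a set closed in \<open>Y k\<close>, and this is closed in \<open>X k\<close> because
  \<open>Y k\<close> is.\<close>

lemma closedin_step_preimage:
  assumes "i \<le> k" "closedin (X k) C"
  shows "closedin (X i) {x. \<exists>y\<in>C. ((i, x), (k, y)) \<in> (step_rel Y f)\<^sup>*}"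
  using assms
proof (induction k arbitrary: C rule: dec_induct)
  case base
  then show ?case by simp
next
  case (step k)
  let ?C = "{z \<in> topspace (subtopology (X k) (Y k)). f k z \<in> C}"
  have "closedin (subtopology (X k) (Y k)) ?C"
    using closedin_continuous_map_preimage[OF cis_continuous step.prems] .
  then have "closedin (X k) ?C"
    using cis_closedin closedin_trans_full by blast
  then have "closedin (X i) {x. \<exists>z\<in>?C. ((i, x), (k, z)) \<in> (step_rel Y f)\<^sup>*}"
    by (rule step.IH)
  also have "{x. \<exists>z\<in>?C. ((i, x), (k, z)) \<in> (step_rel Y f)\<^sup>*}
      = {x. \<exists>y\<in>C. ((i, x), (Suc k, y)) \<in> (step_rel Y f)\<^sup>*}"
    using step.hyps cis_subset[of k] by (auto simp: step_rtrancl_Suc)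
  finally show ?case .
qed

lemma closed_map_glue_map:
  "closed_map (X i) (final_topology X (glue_map Y f)) (glue_map Y f i)"
  unfolding closed_map_def
proof (intro allI impI)
  fix C assume C: "closedin (X i) C"
  let ?A = "glue_map Y f i ` C"
  have "?A \<subseteq> topspace (final_topology X (glue_map Y f))"
    using closedin_subset[OF C] by (auto simp: topspace_final_topology)
  moreover have "closedin (X j) {y \<in> topspace (X j). glue_map Y f j y \<in> ?A}" for j
  proof (cases "i \<le> j")
    case True
    have "{y \<in> topspace (X j). glue_map Y f j y \<in> ?A}
        = {y. \<exists>x\<in>C. ((i, x), (j, y)) \<in> (step_rel Y f)\<^sup>*}"
      using closedin_subset[OF closedin_step_image[OF True C]]
        glue_map_eq_iff[where f = f and Y = Y, OF cis_inj True]
      by (fastforce simp: image_iff)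
    then show ?thesis using closedin_step_image[OF True C] by simp
  next
    case False
    then have "j \<le> i" by simp
    have "{y \<in> topspace (X j). glue_map Y f j y \<in> ?A}
        = {y. \<exists>x\<in>C. ((j, y), (i, x)) \<in> (step_rel Y f)\<^sup>*}"
      using closedin_subset[OF closedin_step_preimage[OF \<open>j \<le> i\<close> C]]
        glue_map_eq_iff[where f = f and Y = Y, OF cis_inj \<open>j \<le> i\<close>]
      by (fastforce simp: image_iff)
    then show ?thesis using closedin_step_preimage[OF \<open>j \<le> i\<close> C] by simp
  qed
  ultimately show "closedin (final_topology X (glue_map Y f)) ?A"
    by (simp add: closedin_final_topology)
qed

lemma embedding_map_glue_map:
  "embedding_map (X i) (final_topology X (glue_map Y f)) (glue_map Y f i)"
proof (rule injective_closed_imp_embedding_map)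
  show "inj_on (glue_map Y f i) (topspace (X i))"
    using glue_map_eq_iff[where f = f and Y = Y, OF cis_inj order_refl]
    by (auto simp: inj_on_def)
qed (rule continuous_map_final_topology closed_map_glue_map)+

lemma glue_map_eq_iff_comp:
  assumes "i < j"
  shows "glue_map Y f i x = glue_map Y f j y \<longleftrightarrow>
    x \<in> comp_dom Y f i (j - 1) \<and> y = comp_map f i (j - 1) x"
  using glue_map_eq_iff[where f = f and Y = Y, OF cis_inj, of i j x y]
    step_rtrancl_iff_comp[of i "j - 1" x y Y f] assms
  by simp

text \<open>What remains beyond \<open>glue_map_eq_iff_comp\<close> is that x and its image under
  f_{i,j-1} lie in \<open>X i\<close> and \<open>X j\<close>; both are ends of a nonempty
  path.\<close>

lemma glue_map_images_Int:
  assumes "i < j"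
  shows "glue_map Y f i ` topspace (X i) \<inter> glue_map Y f j ` topspace (X j) =
    glue_map Y f j ` (comp_map f i (j - 1) ` comp_dom Y f i (j - 1))"
proof -
  have "x \<in> topspace (X i) \<and> comp_map f i (j - 1) x \<in> topspace (X j)"
    if "x \<in> comp_dom Y f i (j - 1)" for x
    using that assms step_rtrancl_topspace[of i "j - 1" x "comp_map f i (j - 1) x"]
      step_rtrancl_iff_comp[of i "j - 1" x "comp_map f i (j - 1) x" Y f]
    by simp
  then show ?thesis
    using glue_map_eq_iff_comp[OF assms] by (fastforce simp: image_iff)
qed

lemma fundamental_limit_space_glue:
  "fundamental_limit_space X Y f (final_topology X (glue_map Y f)) (glue_map Y f)"
proof -
  have "glue_map Y f i ` topspace (X i) \<inter> glue_map Y f j ` topspace (X j) = {}"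
    if "i < j" "\<not> semicomponible Y f i (j - 1)" for i j
  proof -
    \<comment> \<open>Without semicomponibility the domain is empty, so the intersection formula
      yields disjoint images.\<close>
    have "comp_dom Y f i (j - 1) = {}"
      using that comp_dom_nonempty_imp_semicomponible[of i "j - 1" Y f] by linarith
    then show ?thesis using glue_map_images_Int[OF that(1)] by simp
  qed
  then show ?thesis
    unfolding fundamental_limit_space_def limit_space_def
    by (simp add: continuous_map_final_topology embedding_map_glue_map topspace_final_topology
        glue_map_images_Int glue_map_eq_iff_comp closedin_final_topology)
qed

end

theorem theorem3p6:
  fixes X :: "nat \<Rightarrow> 'a topology" and Y :: "nat \<Rightarrow> 'a set" and f :: "nat \<Rightarrow> 'a \<Rightarrow> 'a"
  assumes "closed_injective_system X Y f"
  shows "\<exists>(L :: (nat \<times> 'a) set topology) (\<phi> :: nat \<Rightarrow> 'a \<Rightarrow> (nat \<times> 'a) set).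
           fundamental_limit_space X Y f L \<phi>"
  using fundamental_limit_space_glue[OF assms] by blast

end
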